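(* For every constant $c_1>1$ there is a constant $c_2>0$ depending only on $c_1$, and for every integer $k\ge1$ a constant $C_k>0$ depending only on $k$ and $c_1$, such that the following holds. Let $n,d\ge1$ be integers, $\Omega=[-1,1]^d$, $\varepsilon\in(\frac{c_1}{n},c_1)$ and $\delta\in[0,c_2(e^{\varepsilon}-1))$. Then $$\inf_{\mathcal M \text{ is } (\varepsilon,\delta)\text{-DP}}\ \sup_{X\in\Omega^n}\ \mathbb E\big[d_k(p_X,p_{\mathcal M(X)})\big]\ \ge\ C_k\,(n\varepsilon)^{-\min\{1,k/d\}},$$ where the infimum is over all $(\varepsilon,\delta)$-differentially private algorithms $\mathcal M$ that, on input $X\in\Omega^n$, output synthetic data $\mathcal M(X)\subseteq\Omega$, and the expectation is over the randomness of $\mathcal M$.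
   Context: Synthetic data $\mathcal M(X)\subseteq\Omega$ means a (random) nonempty finite multiset of points of $\Omega$, of any size. For a finite dataset $X=(x_1,\dots,x_N)$ of points of $\Omega$, its empirical distribution is $p_X=\frac1N\sum_{j=1}^N\delta_{x_j}$. A randomized algorithm $\mathcal M:\Omega^n\to\mathcal Z$ is $(\varepsilon,\delta)$-differentially private ($(\varepsilon,\delta)$-DP) if for all $X,X'\in\Omega^n$ that differ in at most one entry and all measurable $S\subseteq\mathcal Z$, $\mathbb P(\mathcal M(X)\in S)\le e^{\varepsilon}\,\mathbb P(\mathcal M(X')\in S)+\delta$. For an integer $k\ge1$, $$\mathcal F_k=\Bigl\{f\in C^k([-1,1]^d;\mathbb R):\ \max_{0\le|\alpha|\le k}\|\partial^\alpha f\|_\infty\le 1\Bigr\},$$ where $\alpha\in\{0,1,2,\dots\}^d$ is a multi-index with $|\alpha|=\sum_i\alpha_i$, and for probability distributions $p,q$ on $[-1,1]^d$, $$d_k(p,q)=\sup_{f\in\mathcal F_k}\left|\int f\,dp-\int f\,dq\right|.$$ *)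

theory Defs
  imports "HOL-Probability.Probability"
begin

text \<open>
  The dimension is quantified inside the theorem, so points of \<open>[-1,1]^d\<close> are
  functions on \<open>{..<d}\<close>, extended by \<open>undefined\<close>.  On this set the product topology of
  \<^typ>\<open>nat \<Rightarrow> real\<close> induces the Euclidean topology.
\<close>

type_synonym point = "nat \<Rightarrow> real"

definition cube :: "nat \<Rightarrow> point set" where
  "cube d = {..<d} \<rightarrow>\<^sub>E {-1..1}"


section \<open>Smooth functions on the cube\<close>

text \<open>Derivatives are taken within the cube, hence are one-sided at its boundary.\<close>

definition pderiv_at :: "nat \<Rightarrow> (point \<Rightarrow> real) \<Rightarrow> point \<Rightarrow> real" where
  "pderiv_at i f x = vector_derivative (\<lambda>t. f (x(i := t))) (at (x i) within {-1..1})"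

definition has_pderiv :: "nat \<Rightarrow> nat \<Rightarrow> (point \<Rightarrow> real) \<Rightarrow> bool" where
  "has_pderiv d i f \<longleftrightarrow>
     (\<forall>x\<in>cube d. (\<lambda>t. f (x(i := t))) differentiable (at (x i) within {-1..1}))"

primrec C_smooth :: "nat \<Rightarrow> nat \<Rightarrow> (point \<Rightarrow> real) \<Rightarrow> bool" where
  "C_smooth d 0 f \<longleftrightarrow> continuous_on (cube d) f"
| "C_smooth d (Suc k) f \<longleftrightarrow> continuous_on (cube d) f \<and>
     (\<forall>i<d. has_pderiv d i f \<and> C_smooth d k (pderiv_at i f))"

definition multi_indices :: "nat \<Rightarrow> nat \<Rightarrow> (nat \<Rightarrow> nat) set" where
  "multi_indices d k = {\<alpha>. (\<forall>i\<ge>d. \<alpha> i = 0) \<and> (\<Sum>i<d. \<alpha> i) \<le> k}"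

definition multi_deriv :: "nat \<Rightarrow> (nat \<Rightarrow> nat) \<Rightarrow> (point \<Rightarrow> real) \<Rightarrow> point \<Rightarrow> real" where
  "multi_deriv d \<alpha> f = foldr (\<lambda>i. pderiv_at i ^^ \<alpha> i) [0..<d] f"

definition F_k :: "nat \<Rightarrow> nat \<Rightarrow> (point \<Rightarrow> real) set" where
  "F_k d k = {f. C_smooth d k f \<and>
     (\<forall>\<alpha>\<in>multi_indices d k. \<forall>x\<in>cube d. \<bar>multi_deriv d \<alpha> f x\<bar> \<le> 1)}"

definition d_k :: "nat \<Rightarrow> nat \<Rightarrow> point measure \<Rightarrow> point measure \<Rightarrow> ennreal" where
  "d_k d k p q = (SUP f\<in>F_k d k. ennreal \<bar>(\<integral>x. f x \<partial>p) - (\<integral>x. f x \<partial>q)\<bar>)"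

definition empirical :: "'a multiset \<Rightarrow> 'a measure" where
  "empirical Y = measure_pmf (pmf_of_multiset Y)"


section \<open>Differential privacy\<close>

definition datasets :: "'a set \<Rightarrow> nat \<Rightarrow> 'a list set" where
  "datasets \<Omega> n = {X. length X = n \<and> set X \<subseteq> \<Omega>}"

text \<open>
  A randomized algorithm is given by the laws \<open>M X\<close> of its outputs on the measurable space \<open>Z\<close>;
  no measurability in \<open>X\<close> is required.
\<close>

definition randomized_algorithm ::
    "'a set \<Rightarrow> nat \<Rightarrow> 'z measure \<Rightarrow> ('a list \<Rightarrow> 'z measure) \<Rightarrow> bool" where
  "randomized_algorithm \<Omega> n Z M \<longleftrightarrow> (\<forall>X\<in>datasets \<Omega> n. M X \<in> space (prob_algebra Z))"

definition differentially_private ::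
    "real \<Rightarrow> real \<Rightarrow> 'a set \<Rightarrow> nat \<Rightarrow> 'z measure \<Rightarrow> ('a list \<Rightarrow> 'z measure) \<Rightarrow> bool" where
  "differentially_private \<epsilon> \<delta> \<Omega> n Z M \<longleftrightarrow>
     (\<forall>X\<in>datasets \<Omega> n. \<forall>X'\<in>datasets \<Omega> n. card {i. i < n \<and> X ! i \<noteq> X' ! i} \<le> 1 \<longrightarrow>
        (\<forall>S\<in>sets Z. measure (M X) S \<le> exp \<epsilon> * measure (M X') S + \<delta>))"

text \<open>
  The measurable space of nonempty finite multisets of points of the cube carries the
  usual \<open>\<sigma>\<close>-algebra of finite point processes: the one generated by the maps counting
  the points, with multiplicity, in a Borel set \<open>B\<close>.
\<close>

definition synthetic_data :: "nat \<Rightarrow> point multiset set" where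
  "synthetic_data d = {Y. Y \<noteq> {#} \<and> set_mset Y \<subseteq> cube d}"

definition synthetic_space :: "nat \<Rightarrow> point multiset measure" where
  "synthetic_space d = sigma (synthetic_data d)
     {{Y \<in> synthetic_data d. size (filter_mset (\<lambda>x. x \<in> B) Y) = j} | B j.
        B \<in> sets (restrict_space borel (cube d))}"

definition private_algorithms ::
    "nat \<Rightarrow> nat \<Rightarrow> real \<Rightarrow> real \<Rightarrow> (point list \<Rightarrow> point multiset measure) set" where
  "private_algorithms d n \<epsilon> \<delta> =
     {M. randomized_algorithm (cube d) n (synthetic_space d) M \<and>
         differentially_private \<epsilon> \<delta> (cube d) n (synthetic_space d) M}"

end

theory Submission
  imports Defs
begin

text \<open>
  The lower bound is an instance of Assouad's method. Let \<open>s\<close> be about \<open>1/\<epsilon>\<close>. Split the cube into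
  \<open>m^d\<close> congruent cells and pick \<open>N\<close> of them with \<open>N * s \<le> n\<close>. To every \<open>b \<subseteq> {..<N}\<close> belongs a
  dataset \<open>X b\<close> with \<open>s\<close> copies of the centre of cell \<open>j\<close> for each \<open>j \<in> b\<close>, and with all remaining
  points at a corner of the cube. Cell \<open>j\<close> carries a bump \<open>\<phi> j\<close> that is 1 at its centre and 0
  outside. Since the bumps have disjoint supports, every combination \<open>\<Sum>j. \<sigma> j * \<phi> j / (B * m)^k\<close> with
  \<open>\<bar>\<sigma> j\<bar> \<le> 1\<close> lies in \<open>F_k\<close>, where \<open>B\<close> depends only on \<open>k\<close>; choosing the signs \<open>\<sigma>\<close> well,
  \<open>d_k p_(X b) p_Y \<ge> (B * m)^(-k) * (\<Sum>j<N. \<bar>p_(X b) (\<phi> j) - p_Y (\<phi> j)\<bar>)\<close>.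
  Here \<open>p_(X b) (\<phi> j)\<close> is \<open>s/n\<close> or \<open>0\<close>, according to whether \<open>j \<in> b\<close>. Hence the \<open>j\<close>-th term is at least
  \<open>s/(2*n)\<close> whenever the output \<open>Y\<close> puts \<open>p_Y (\<phi> j)\<close> on the wrong side of \<open>s/(2*n)\<close>.

  Changing bit \<open>j\<close> of \<open>b\<close> changes only \<open>s\<close> data points. By group privacy the output laws of \<open>X b\<close> and of
  its neighbour are comparable up to the constants \<open>exp (s * \<epsilon>) \<le> exp (1 + c1)\<close> and \<open>1/2\<close>, so on at least
  one of the two datasets the output errs at \<open>j\<close> with probability bounded below. Averaging over \<open>b\<close>
  yields a dataset with error of order \<open>m^(-k) * N * s / n\<close> (\<open>assouad_lower_bound\<close>).

  For \<open>k \<ge> d\<close> a single cell, \<open>N = m = 1\<close>, gives \<open>s/n \<ge> 1/(n * \<epsilon>)\<close>. For \<open>k < d\<close> take \<open>N = n div s\<close> cells,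
  so that \<open>N * s \<ge> n/2\<close>, in a grid with \<open>m \<le> 2 * N^(1/d) \<le> 2 * (n * \<epsilon>)^(1/d)\<close> (\<open>grid_lower_bound\<close>).

  The constants must not depend on \<open>d\<close>. Two choices achieve this. The bumps are products of
  one-variable bumps with values in \<open>[0,1]\<close>: a derivative of order at most \<open>k\<close> differentiates at most
  \<open>k\<close> of the \<open>d\<close> factors, and only those can exceed 1. And for \<open>k < d\<close> only \<open>N\<close> of the \<open>m^d\<close> cells are used: the largest
  full grid with at most \<open>n div s\<close> cells may have fewer cells by a factor exponential in \<open>d\<close>.
\<close>

section \<open>Compactly supported bumps on the line\<close>

definition truncated :: "real poly \<Rightarrow> real \<Rightarrow> real" where
  "truncated p t = (if \<bar>t\<bar> < 1 then poly p t else 0)"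

text \<open>
  At \<open>t = \<plusminus>1\<close> the truncation is dominated by \<open>\<bar>p\<bar>\<close>, whose difference quotient tends to 0 there; so the
  two branches glue differentiably.
\<close>

lemma truncated_has_derivative:
  assumes "\<And>e. \<bar>e\<bar> = 1 \<Longrightarrow> poly p e = 0 \<and> poly (pderiv p) e = 0"
  shows "(truncated p has_real_derivative truncated (pderiv p) t) (at t)"
proof -
  consider "\<bar>t\<bar> < 1" | "\<bar>t\<bar> > 1" | "\<bar>t\<bar> = 1" by linarith
  then show ?thesis
  proof cases
    case 1
    have "((\<lambda>t. poly p t) has_real_derivative truncated (pderiv p) t) (at t)"
      using 1 by (auto simp: truncated_def intro: poly_DERIV)
    then show ?thesis
      by (rule has_field_derivative_transform_within_open[where S = "{-1<..<1}"])
        (use 1 in \<open>auto simp: truncated_def abs_less_iff\<close>)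
  next
    case 2
    have "((\<lambda>_. 0) has_real_derivative truncated (pderiv p) t) (at t)"
      using 2 by (auto simp: truncated_def)
    then show ?thesis
      by (rule has_field_derivative_transform_within_open[where S = "- {-1..1}"])
        (use 2 in \<open>auto simp: truncated_def\<close>)
  next
    case 3
    have "((\<lambda>y. (poly p y - poly p t) / (y - t)) \<longlongrightarrow> 0) (at t)"
      using poly_DERIV[of p t] assms[OF 3] unfolding has_field_derivative_iff by simp
    then have "((\<lambda>y. (truncated p y - truncated p t) / (y - t)) \<longlongrightarrow> 0) (at t)"
      by (rule Lim_null_comparison[OF always_eventually, OF allI tendsto_norm_zero, rotated])
        (use 3 assms in \<open>auto simp: truncated_def divide_simps\<close>)
    then show ?thesis using 3 unfolding has_field_derivative_iff by (simp add: truncated_def)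
  qed
qed

lemma power_dvd_pderiv:
  fixes q p :: "real poly"
  assumes "q ^ Suc r dvd p" shows "q ^ r dvd pderiv p"
proof -
  obtain u where u: "p = q ^ Suc r * u" using assms by (elim dvdE)
  have "pderiv p = q ^ r * (smult (of_nat (Suc r)) (pderiv q) * u + q * pderiv u)"
    unfolding u pderiv_mult pderiv_power_Suc by (simp add: algebra_simps)
  then show ?thesis by simp
qed

text \<open>
  The bump is \<open>(1 - t\<^sup>2)^(k + 2)\<close>, cut off outside \<open>(-1, 1)\<close>: its derivatives of order up to \<open>k + 1\<close> vanish
  at \<open>\<plusminus>1\<close>. The bound has the form \<open>B ^ l\<close> so that order 0 gets the constant 1, and so that bounds for
  factors of different orders multiply to \<open>B\<close> to the total order.
\<close>

lemma smooth_bump_exists: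
  fixes k :: nat
  obtains B :: real and \<psi> :: "nat \<Rightarrow> real \<Rightarrow> real"
  where "B \<ge> 1" "\<psi> 0 0 = 1"
    "\<And>l t. \<bar>t\<bar> \<ge> 1 \<Longrightarrow> \<psi> l t = 0"
    "\<And>l t. l \<le> k \<Longrightarrow> (\<psi> l has_real_derivative \<psi> (Suc l) t) (at t)"
    "\<And>l t. l \<le> k \<Longrightarrow> \<bar>\<psi> l t\<bar> \<le> B ^ l"
    "\<And>t. \<psi> 0 t \<ge> 0"
proof -
  define q :: "real poly" where "q = [:1, 0, -1:]"
  define P where "P l = (pderiv ^^ l) (q ^ (k + 2))" for l
  define \<psi> where "\<psi> l = truncated (P l)" for l
  have dvd: "q ^ (k + 2 - l) dvd P l" if "l \<le> k + 2" for l
    using that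
  proof (induction l)
    case (Suc l)
    then have "Suc (k + 2 - Suc l) = k + 2 - l" by simp
    with Suc have "q ^ Suc (k + 2 - Suc l) dvd P l" by simp
    then show ?case unfolding P_def using power_dvd_pderiv by simp
  qed (simp add: P_def)
  have vanish: "poly (P l) e = 0" if "l \<le> Suc k" "\<bar>e\<bar> = 1" for l e
  proof -
    have "q dvd q ^ (k + 2 - l)" using that by (intro dvd_power) auto
    also have "\<dots> dvd P l" using that by (intro dvd) simp
    finally have "q dvd P l" .
    moreover have "poly q e = 0" using that(2) by (auto simp: q_def abs_if split: if_splits)
    ultimately show ?thesis by auto
  qed
  have P_Suc: "P (Suc l) = pderiv (P l)" for l by (simp add: P_def)
  have "\<exists>b. \<forall>t. \<bar>\<psi> l t\<bar> \<le> b" for l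
  proof -
    have "compact (poly (P l) ` {-1..1})"
      by (intro compact_continuous_image continuous_intros) auto
    then obtain b where b: "\<forall>y\<in>poly (P l) ` {-1..1}. norm y \<le> b"
      using compact_imp_bounded bounded_iff by metis
    have pb: "\<bar>poly (P l) t\<bar> \<le> b" if "\<bar>t\<bar> < 1" for t
      using b that by (auto simp: abs_less_iff)
    from pb[of 0] have "b \<ge> 0" by linarith
    with pb have "\<bar>\<psi> l t\<bar> \<le> b" for t by (simp add: \<psi>_def truncated_def)
    then show ?thesis by blast
  qed
  then obtain b where b: "\<And>l t. \<bar>\<psi> l t\<bar> \<le> b l" by metis
  have b0: "b l \<ge> 0" for l using b[of l 0] by linarith
  define B where "B = 1 + (\<Sum>l\<le>k. b l)"
  have B1: "B \<ge> 1" using b0 by (simp add: B_def sum_nonneg)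
  have poly_P0: "poly (P 0) t = (1 - t\<^sup>2) ^ (k + 2)" for t
    by (simp only: P_def funpow_0 poly_power) (simp add: q_def power2_eq_square)
  have square: "0 \<le> 1 - t\<^sup>2" "1 - t\<^sup>2 \<le> 1" if "\<bar>t\<bar> < 1" for t :: real
    using that by (simp_all add: abs_square_le_1)
  have nonneg: "\<psi> 0 t \<ge> 0" for t
    using square by (auto simp: \<psi>_def truncated_def poly_P0 simp del: power_Suc)
  have bound: "\<bar>\<psi> l t\<bar> \<le> B ^ l" if "l \<le> k" for l t
  proof (cases "l = 0")
    case True
    have "\<psi> 0 t \<le> 1"
      using square by (auto simp: \<psi>_def truncated_def poly_P0 intro!: power_le_one simp del: power_Suc)
    then show ?thesis using True nonneg[of t] by simp
  next
    case False
    have "\<bar>\<psi> l t\<bar> \<le> b l" by (rule b)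
    also have "\<dots> \<le> B" using member_le_sum[of l "{..k}" b] that b0 by (simp add: B_def)
    also have "\<dots> \<le> B ^ l" using B1 False by (simp add: self_le_power)
    finally show ?thesis .
  qed
  show ?thesis
  proof (rule that[OF B1, of \<psi>])
    show "(\<psi> l has_real_derivative \<psi> (Suc l) t) (at t)" if "l \<le> k" for l t
      unfolding \<psi>_def P_Suc
      by (rule truncated_has_derivative) (use vanish[of l] vanish[of "Suc l"] that P_Suc in auto)
  qed (use bound nonneg in \<open>auto simp: \<psi>_def truncated_def P_def q_def\<close>)
qed

section \<open>Separable functions on the cube\<close>

text \<open>
  Linear combinations of products of one-variable functions. The argument \<open>l\<close> of \<open>G j i l\<close> stands for the
  order of differentiation, so that partial differentiation merely increments an entry of \<open>\<alpha>\<close>.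
\<close>

definition separable ::
    "nat \<Rightarrow> nat \<Rightarrow> (nat \<Rightarrow> real) \<Rightarrow> (nat \<Rightarrow> nat \<Rightarrow> nat \<Rightarrow> real \<Rightarrow> real) \<Rightarrow> (nat \<Rightarrow> nat) \<Rightarrow> point \<Rightarrow> real" where
  "separable N d c G \<alpha> x = (\<Sum>j<N. c j * (\<Prod>i<d. G j i (\<alpha> i) (x i)))"

lemma cube_update: "x \<in> cube d \<Longrightarrow> i < d \<Longrightarrow> t \<in> {-1..1} \<Longrightarrow> x(i := t) \<in> cube d"
  by (auto simp: cube_def PiE_iff extensional_def)

lemma separable_update_derivative:
  assumes i: "i < d"
    and G: "\<And>j. j < N \<Longrightarrow> (G j i (\<alpha> i) has_real_derivative G j i (Suc (\<alpha> i)) t) (at t)"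
  shows "((\<lambda>t. separable N d c G \<alpha> (x(i := t))) has_real_derivative
    separable N d c G (\<alpha>(i := Suc (\<alpha> i))) (x(i := t))) (at t)"
proof -
  define R where "R j = (\<Prod>l\<in>{..<d} - {i}. G j l (\<alpha> l) (x l))" for j
  have factor: "(\<Prod>l<d. G j l (\<beta> l) ((x(i := u)) l)) = G j i (\<beta> i) u * R j"
    if "\<And>l. l \<noteq> i \<Longrightarrow> \<beta> l = \<alpha> l" for j \<beta> u
  proof -
    have "(\<Prod>l<d. G j l (\<beta> l) ((x(i := u)) l)) =
        G j i (\<beta> i) ((x(i := u)) i) * (\<Prod>l\<in>{..<d} - {i}. G j l (\<beta> l) ((x(i := u)) l))"
      using i by (intro prod.remove) auto
    also have "(\<Prod>l\<in>{..<d} - {i}. G j l (\<beta> l) ((x(i := u)) l)) = R j"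
      unfolding R_def using that by (intro prod.cong) auto
    finally show ?thesis by simp
  qed
  have "((\<lambda>u. \<Sum>j<N. c j * (G j i (\<alpha> i) u * R j)) has_real_derivative
      (\<Sum>j<N. c j * (G j i (Suc (\<alpha> i)) t * R j))) (at t)"
    by (intro DERIV_sum DERIV_cmult DERIV_cmult_right G) auto
  moreover have "separable N d c G \<alpha> (x(i := u)) = (\<Sum>j<N. c j * (G j i (\<alpha> i) u * R j))" for u
    unfolding separable_def by (simp only: factor)
  moreover have "separable N d c G (\<alpha>(i := Suc (\<alpha> i))) (x(i := t)) =
      (\<Sum>j<N. c j * (G j i (Suc (\<alpha> i)) t * R j))"
    unfolding separable_def
    by (rule sum.cong[OF refl], subst factor) auto
  ultimately show ?thesis by (simp only:)
qed

text \<open>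
  The partial derivatives are determined only on the cube: outside of it, \<open>pderiv_at\<close> may
  take arbitrary values. The lemmas below therefore speak about any \<open>f\<close> that agrees with a separable function
  on the cube, a property that is preserved by differentiation.
\<close>

locale separable_family =
  fixes N d k :: nat and G :: "nat \<Rightarrow> nat \<Rightarrow> nat \<Rightarrow> real \<Rightarrow> real"
  assumes G_deriv: "\<And>j i l t. j < N \<Longrightarrow> i < d \<Longrightarrow> l \<le> k \<Longrightarrow>
    (G j i l has_real_derivative G j i (Suc l) t) (at t)"
begin

lemma continuous_on_separable:
  assumes "\<And>i. i < d \<Longrightarrow> \<alpha> i \<le> k"
  shows "continuous_on (cube d) (separable N d c G \<alpha>)"
proof -
  have "continuous_on (cube d) (\<lambda>x. G j i (\<alpha> i) (x i))" if "j < N" "i < d" for j i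
  proof -
    have "continuous_on UNIV (G j i (\<alpha> i))"
      using G_deriv[OF that] assms[OF that(2)] by (meson DERIV_continuous_on has_field_derivative_at_within)
    then show ?thesis
      by (rule continuous_on_compose2) (auto intro: continuous_on_product_coordinates continuous_on_subset)
  qed
  then show ?thesis unfolding separable_def
    by (intro continuous_on_sum continuous_on_mult continuous_on_prod continuous_on_const) auto
qed

lemma separable_partial_derivative:
  assumes f: "\<And>y. y \<in> cube d \<Longrightarrow> f y = separable N d c G \<alpha> y"
    and i: "i < d" "\<alpha> i \<le> k" and x: "x \<in> cube d"
  shows "((\<lambda>t. f (x(i := t))) has_vector_derivative
    separable N d c G (\<alpha>(i := Suc (\<alpha> i))) x) (at (x i) within {-1..1})"
proof (rule has_vector_derivative_transform)
  show xi: "x i \<in> {-1..1}" using x i by (auto simp: cube_def PiE_iff)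
  show "f (x(i := t)) = separable N d c G \<alpha> (x(i := t))" if "t \<in> {-1..1}" for t
    using f cube_update[OF x i(1) that] by simp
  show "((\<lambda>t. separable N d c G \<alpha> (x(i := t))) has_vector_derivative
    separable N d c G (\<alpha>(i := Suc (\<alpha> i))) x) (at (x i) within {-1..1})"
    using separable_update_derivative[of i d N G \<alpha> "x i" c x] G_deriv i
    by (auto simp: has_real_derivative_iff_has_vector_derivative intro: has_vector_derivative_at_within)
qed

lemma pderiv_at_separable:
  assumes f: "\<And>y. y \<in> cube d \<Longrightarrow> f y = separable N d c G \<alpha> y"
    and i: "i < d" "\<alpha> i \<le> k" and x: "x \<in> cube d"
  shows "pderiv_at i f x = separable N d c G (\<alpha>(i := Suc (\<alpha> i))) x"
  unfolding pderiv_at_def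
  by (rule vector_derivative_within_closed_interval)
    (use separable_partial_derivative[where f = f and \<alpha> = \<alpha>, OF f i x] x i in \<open>auto simp: cube_def PiE_iff\<close>)

lemma C_smooth_separable:
  assumes "\<And>y. y \<in> cube d \<Longrightarrow> f y = separable N d c G \<alpha> y"
    and "\<And>i. i < d \<Longrightarrow> \<alpha> i + r \<le> k"
  shows "C_smooth d r f"
  using assms
proof (induction r arbitrary: f \<alpha>)
  case 0
  then show ?case
    using continuous_on_separable[where \<alpha> = \<alpha>] by (simp cong: continuous_on_cong)
next
  case (Suc r)
  have le: "\<alpha> i + Suc r \<le> k" if "i < d" for i using Suc.prems(2) that .
  have "continuous_on (cube d) (separable N d c G \<alpha>)"
    by (rule continuous_on_separable) (use le in force)
  then have "continuous_on (cube d) f"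
    using Suc.prems(1) by (simp cong: continuous_on_cong)
  moreover have "has_pderiv d i f" if "i < d" for i
    unfolding has_pderiv_def
    using separable_partial_derivative[where f = f and \<alpha> = \<alpha>, OF Suc.prems(1) that] le[OF that]
    by (meson add_leD1 differentiableI_vector)
  moreover have "C_smooth d r (pderiv_at i f)" if "i < d" for i
  proof (rule Suc.IH)
    show "pderiv_at i f y = separable N d c G (\<alpha>(i := Suc (\<alpha> i))) y" if "y \<in> cube d" for y
      using pderiv_at_separable[where f = f and \<alpha> = \<alpha>, OF Suc.prems(1) \<open>i < d\<close> _ that] le[OF \<open>i < d\<close>] by simp
    show "(\<alpha>(i := Suc (\<alpha> i))) l + r \<le> k" if "l < d" for l
      using le[OF that] by auto
  qed
  ultimately show ?case by simp
qed

lemma multi_deriv_separable: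
  assumes f: "\<And>y. y \<in> cube d \<Longrightarrow> f y = separable N d c G (\<lambda>_. 0) y"
    and \<alpha>: "\<And>i. i < d \<Longrightarrow> \<alpha> i \<le> k" and x: "x \<in> cube d"
  shows "multi_deriv d \<alpha> f x = separable N d c G \<alpha> x"
proof -
  \<comment> \<open>Repeated differentiation in one variable, then \<open>multi_deriv\<close> one variable after the other.\<close>
  have iterate: "(pderiv_at i ^^ l) g y = separable N d c G (\<beta>(i := \<beta> i + l)) y"
    if "\<And>y. y \<in> cube d \<Longrightarrow> g y = separable N d c G \<beta> y" "i < d" "\<beta> i + l \<le> k" "y \<in> cube d"
    for i l g \<beta> y
    using that(3,4)
  proof (induction l arbitrary: y)
    case (Suc l)
    have "pderiv_at i ((pderiv_at i ^^ l) g) y =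
        separable N d c G ((\<beta>(i := \<beta> i + l))(i := Suc ((\<beta>(i := \<beta> i + l)) i))) y"
      by (rule pderiv_at_separable[OF Suc.IH]) (use Suc.prems that(2) in auto)
    then show ?case by (simp add: fun_upd_same del: fun_upd_apply)
  qed (use that in simp)
  have "foldr (\<lambda>i. pderiv_at i ^^ \<alpha> i) xs f y =
      separable N d c G (\<lambda>i. if i \<in> set xs then \<alpha> i else 0) y"
    if "distinct xs" "set xs \<subseteq> {..<d}" "y \<in> cube d" for xs y
    using that
  proof (induction xs arbitrary: y)
    case (Cons i xs)
    let ?\<beta> = "\<lambda>l. if l \<in> set xs then \<alpha> l else 0"
    have "(pderiv_at i ^^ \<alpha> i) (foldr (\<lambda>i. pderiv_at i ^^ \<alpha> i) xs f) y =
        separable N d c G (?\<beta>(i := ?\<beta> i + \<alpha> i)) y"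
      by (rule iterate) (use Cons \<alpha> in auto)
    also have "?\<beta>(i := ?\<beta> i + \<alpha> i) = (\<lambda>l. if l \<in> set (i # xs) then \<alpha> l else 0)"
      using Cons.prems by auto
    finally show ?case by simp
  qed (use f in simp)
  from this[of "[0..<d]" x] x
  have "multi_deriv d \<alpha> f x = separable N d c G (\<lambda>i. if i < d then \<alpha> i else 0) x"
    by (simp add: multi_deriv_def lessThan_atLeast0)
  then show ?thesis by (simp add: separable_def)
qed

lemma separable_in_F_k:
  assumes "\<And>\<alpha> x. \<alpha> \<in> multi_indices d k \<Longrightarrow> x \<in> cube d \<Longrightarrow> \<bar>separable N d c G \<alpha> x\<bar> \<le> 1"
  shows "separable N d c G (\<lambda>_. 0) \<in> F_k d k"
proof -
  have "multi_deriv d \<alpha> (separable N d c G (\<lambda>_. 0)) x = separable N d c G \<alpha> x"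
    if "\<alpha> \<in> multi_indices d k" "x \<in> cube d" for \<alpha> x
  proof (rule multi_deriv_separable)
    show "\<alpha> i \<le> k" if "i < d" for i
      using member_le_sum[of i "{..<d}" \<alpha>] that \<open>\<alpha> \<in> multi_indices d k\<close>
      by (simp add: multi_indices_def)
  qed (use that in auto)
  moreover have "C_smooth d k (separable N d c G (\<lambda>_. 0))"
    by (rule C_smooth_separable[where \<alpha> = "\<lambda>_. 0"]) auto
  ultimately show ?thesis using assms by (simp add: F_k_def)
qed

end

section \<open>Bumps on a grid of cells\<close>

text \<open>
  A grid of \<open>m^d\<close> cells of side \<open>2 / m\<close>, of which \<open>a\<close> selects \<open>N\<close>. Each derivative costs a factor \<open>m\<close> from
  rescaling and a factor \<open>B\<close> from the one-variable bump, so that dividing by \<open>(B * m) ^ k\<close> normalizes all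
  derivatives up to order \<open>k\<close>, whatever \<open>d\<close> is. By disjointness of the supports, the sum over \<open>j\<close> has at
  most one nonzero term at each point.
\<close>

lemma bump_family:
  fixes k :: nat
  obtains B :: real where "B \<ge> 1"
    "\<And>(m::nat) d N. m \<ge> 1 \<Longrightarrow> d \<ge> 1 \<Longrightarrow> N \<le> m ^ d \<Longrightarrow>
      \<exists>(\<phi> :: nat \<Rightarrow> point \<Rightarrow> real) w z.
        w \<in> cube d \<and> z \<in> {..<N} \<rightarrow> cube d \<and>
        (\<forall>j<N. continuous_on (cube d) (\<phi> j) \<and> (\<forall>x. \<phi> j x \<ge> 0) \<and> \<phi> j w = 0 \<and>
          (\<forall>i<N. \<phi> j (z i) = of_bool (i = j))) \<and>
        (\<forall>\<sigma>. (\<forall>j<N. \<bar>\<sigma> j\<bar> \<le> 1) \<longrightarrow> (\<lambda>x. \<Sum>j<N. \<sigma> j / (B * m) ^ k * \<phi> j x) \<in> F_k d k)"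
proof (rule smooth_bump_exists[of k])
  fix B :: real and \<psi> :: "nat \<Rightarrow> real \<Rightarrow> real"
  assume B: "B \<ge> 1" and \<psi>0: "\<psi> 0 0 = 1"
    and supp: "\<And>l t. \<bar>t\<bar> \<ge> 1 \<Longrightarrow> \<psi> l t = 0"
    and deriv: "\<And>l t. l \<le> k \<Longrightarrow> (\<psi> l has_real_derivative \<psi> (Suc l) t) (at t)"
    and bound: "\<And>l t. l \<le> k \<Longrightarrow> \<bar>\<psi> l t\<bar> \<le> B ^ l"
    and nonneg: "\<And>t. \<psi> 0 t \<ge> 0"
  show thesis
  proof (rule that[OF B], goal_cases)
    case (1 m d N)
    have "card {..<N} \<le> card ({..<d} \<rightarrow>\<^sub>E {..<m})"
      using 1 by (simp add: card_PiE)
    then obtain a where a: "inj_on a {..<N}" "a ` {..<N} \<subseteq> {..<d} \<rightarrow>\<^sub>E {..<m}"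
      by (metis card_le_inj finite_PiE finite_lessThan)
    have a_less: "a j i < m" if "j < N" "i < d" for j i
      using a(2) that by (fastforce simp: PiE_iff)
    \<comment> \<open>\<open>u j i\<close> maps the \<open>i\<close>-th side of cell \<open>j\<close> affinely onto \<open>[-1, 1]\<close>; at \<open>-1\<close> it takes an odd value, so
      the corner \<open>w\<close> lies outside the open cell.\<close>
    define u where "u j i t = m * t + m - (2 * real (a j i) + 1)" for j i and t :: real
    define G where "G j i l t = m ^ l * \<psi> l (u j i t)" for j i l t
    define c where "c \<sigma> j = \<sigma> j / (B * m) ^ k" for \<sigma> :: "nat \<Rightarrow> real" and j
    define \<phi> where "\<phi> j x = (\<Prod>i<d. G j i 0 (x i))" for j x
    define w :: point where "w i = (if i < d then -1 else undefined)" for i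
    define z :: "nat \<Rightarrow> point" where
      "z j i = (if i < d then (2 * real (a j i) + 1) / m - 1 else undefined)" for j i
    interpret separable_family N d k G
    proof
      fix j i l t assume *: "j < N" "i < d" "l \<le> k"
      have "(\<psi> l has_real_derivative \<psi> (Suc l) (u j i t)) (at (u j i t))"
        using deriv * by simp
      moreover have "(u j i has_real_derivative m) (at t)"
        unfolding u_def by (auto intro!: derivative_eq_intros)
      ultimately have "((\<lambda>t. \<psi> l (u j i t)) has_real_derivative \<psi> (Suc l) (u j i t) * m) (at t)"
        by (rule DERIV_chain2)
      then show "(G j i l has_real_derivative G j i (Suc l) t) (at t)"
        unfolding G_def by (auto intro!: derivative_eq_intros)
    qed
    have w: "w \<in> cube d" by (auto simp: w_def cube_def PiE_iff extensional_def)
    have z: "z j \<in> cube d" if "j < N" for j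
    proof -
      have "(2 * real (a j i) + 1) / m \<le> 2" if "i < d" for i
      proof -
        have "2 * a j i + 1 \<le> 2 * m" using a_less[OF \<open>j < N\<close> that] by simp
        then have "2 * real (a j i) + 1 \<le> 2 * real m" by linarith
        then show ?thesis using 1(1) by (simp add: divide_simps)
      qed
      then show ?thesis by (auto simp: z_def cube_def PiE_iff extensional_def algebra_simps)
    qed
    have separation: "\<bar>u j i t\<bar> \<ge> 1 \<or> \<bar>u j' i t\<bar> \<ge> 1" if "a j i \<noteq> a j' i" for j j' i t
    proof -
      have "\<bar>real (a j i) - real (a j' i)\<bar> \<ge> 1" using that by linarith
      then show ?thesis by (auto simp: u_def abs_if split: if_splits)
    qed
    have differ: "\<exists>i<d. a j i \<noteq> a j' i" if "j < N" "j' < N" "j \<noteq> j'" for j j'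
    proof (rule ccontr)
      assume "\<not> ?thesis"
      then have "a j = a j'" using a(2) that
        by (intro PiE_ext[of _ "{..<d}" "\<lambda>_. {..<m}"]) auto
      with a(1) that show False by (auto simp: inj_on_def)
    qed
    have disjoint: "(\<Prod>i<d. G j i (\<alpha> i) (x i)) = 0 \<or> (\<Prod>i<d. G j' i (\<beta> i) (x i)) = 0"
      if "j < N" "j' < N" "j \<noteq> j'" for j j' \<alpha> \<beta> x
      using differ[OF that] separation supp by (force simp: prod_zero_iff G_def)
    have small: "\<bar>separable N d (c \<sigma>) G \<alpha> x\<bar> \<le> 1"
      if \<sigma>: "\<And>j. j < N \<Longrightarrow> \<bar>\<sigma> j\<bar> \<le> 1" and \<alpha>: "\<alpha> \<in> multi_indices d k" for \<sigma> \<alpha> x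
    proof -
      define p where "p j = (\<Prod>i<d. G j i (\<alpha> i) (x i))" for j
      have Bm: "B * m \<ge> 1" using B 1(1) by (simp add: mult_ge1_I)
      have p: "\<bar>p j\<bar> \<le> (B * m) ^ k" for j
      proof -
        have "\<bar>p j\<bar> = (\<Prod>i<d. \<bar>G j i (\<alpha> i) (x i)\<bar>)" unfolding p_def by (rule abs_prod)
        also have "\<dots> \<le> (\<Prod>i<d. (B * m) ^ \<alpha> i)"
        proof (intro prod_mono conjI)
          fix i assume "i \<in> {..<d}"
          then have "\<alpha> i \<le> k"
            using member_le_sum[of i "{..<d}" \<alpha>] \<alpha> by (simp add: multi_indices_def)
          then show "\<bar>G j i (\<alpha> i) (x i)\<bar> \<le> (B * m) ^ \<alpha> i"
            unfolding G_def abs_mult power_mult_distrib using bound[of "\<alpha> i"]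
            by (simp add: mult.commute[of "B ^ \<alpha> i"] mult_left_mono)
        qed simp
        also have "\<dots> = (B * m) ^ (\<Sum>i<d. \<alpha> i)" by (simp add: power_sum)
        also have "\<dots> \<le> (B * m) ^ k"
          using \<alpha> Bm by (intro power_increasing) (auto simp: multi_indices_def)
        finally show ?thesis .
      qed
      have term_le: "\<bar>c \<sigma> j * p j\<bar> \<le> 1" if "j < N" for j
      proof -
        have "\<bar>c \<sigma> j * p j\<bar> = \<bar>\<sigma> j\<bar> * (\<bar>p j\<bar> / (B * m) ^ k)"
          using Bm by (simp add: c_def abs_mult)
        also have "\<dots> \<le> 1 * 1"
          using \<sigma>[OF that] p[of j] Bm by (intro mult_mono) (auto simp: divide_simps)
        finally show ?thesis by simp
      qed
      show ?thesis
      proof (cases "\<exists>j<N. p j \<noteq> 0")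
        case True
        then obtain j where j: "j < N" "p j \<noteq> 0" by blast
        have "separable N d (c \<sigma>) G \<alpha> x = (\<Sum>j\<in>{j}. c \<sigma> j * p j)"
          unfolding separable_def p_def[symmetric]
          using j disjoint[of _ j \<alpha> x \<alpha>] by (intro sum.mono_neutral_right) (auto simp: p_def)
        then show ?thesis using term_le[OF j(1)] by simp
      next
        case False
        then show ?thesis by (simp add: separable_def flip: p_def)
      qed
    qed
    show ?case
    proof (intro exI[of _ \<phi>] exI[of _ w] exI[of _ z] conjI allI impI)
      show "w \<in> cube d" by (rule w)
      show "z \<in> {..<N} \<rightarrow> cube d" using z by auto
      show "continuous_on (cube d) (\<phi> j)" if "j < N" for j
      proof -
        have "continuous_on (cube d) (separable N d (\<lambda>i. of_bool (i = j)) G (\<lambda>_. 0))"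
          by (rule continuous_on_separable) simp
        also have "separable N d (\<lambda>i. of_bool (i = j)) G (\<lambda>_. 0) = \<phi> j"
          using that by (simp add: separable_def \<phi>_def fun_eq_iff of_bool_def if_distrib[of "\<lambda>x. x * _"] cong: if_cong)
        finally show ?thesis .
      qed
      show "\<phi> j x \<ge> 0" for j x unfolding \<phi>_def G_def by (intro prod_nonneg) (simp add: nonneg)
      show "\<phi> j w = 0" if "j < N" for j
        unfolding \<phi>_def using 1(2) by (auto simp: prod_zero_iff G_def u_def w_def intro!: supp bexI[of _ 0])
      have one: "\<phi> j (z j) = 1" for j
        unfolding \<phi>_def using 1(1) \<psi>0 by (intro prod.neutral) (simp add: G_def u_def z_def field_simps)
      show "\<phi> j (z i) = of_bool (i = j)" if "j < N" "i < N" for i j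
        using one[of j] one[of i] disjoint[OF that, of "\<lambda>_. 0" "z i" "\<lambda>_. 0"] unfolding \<phi>_def by auto
      show "(\<lambda>x. \<Sum>j<N. \<sigma> j / (B * m) ^ k * \<phi> j x) \<in> F_k d k" if "\<forall>j<N. \<bar>\<sigma> j\<bar> \<le> 1" for \<sigma>
      proof -
        have "separable N d (c \<sigma>) G (\<lambda>_. 0) \<in> F_k d k"
          by (rule separable_in_F_k, rule small) (use that in simp_all)
        then show ?thesis
          by (simp add: separable_def[abs_def] c_def[abs_def] \<phi>_def[abs_def])
      qed
    qed
  qed
qed

section \<open>Group privacy and measurability of empirical means\<close>

text \<open>
  Walk from \<open>X\<close> to \<open>X'\<close> by changing one entry at a time; the additive errors form a geometric sum.
\<close>

lemma group_privacy:
  assumes dp: "differentially_private \<epsilon> \<delta> \<Omega> n Z M" and "\<epsilon> \<ge> 0" "\<delta> \<ge> 0"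
    and X: "X \<in> datasets \<Omega> n" and X': "X' \<in> datasets \<Omega> n"
    and "card {i. i < n \<and> X ! i \<noteq> X' ! i} \<le> s" and S: "S \<in> sets Z"
  shows "measure (M X) S \<le> exp (real s * \<epsilon>) * measure (M X') S + \<delta> * (\<Sum>t<s. exp (real t * \<epsilon>))"
  using X assms(6)
proof (induction s arbitrary: X)
  case 0
  then have "X = X'" using X' by (intro nth_equalityI) (auto simp: datasets_def)
  then show ?case by simp
next
  case (Suc s)
  define D where "D = {i. i < n \<and> X ! i \<noteq> X' ! i}"
  show ?case
  proof (cases "D = {}")
    case True
    then have eq: "X = X'" using X' Suc.prems by (intro nth_equalityI) (auto simp: datasets_def D_def)
    have grow: "measure (M X') S \<le> exp (real (Suc s) * \<epsilon>) * measure (M X') S"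
      using \<open>\<epsilon> \<ge> 0\<close> by (simp add: mult_le_cancel_right1 measure_nonneg not_less)
    have "\<delta> * (\<Sum>t<Suc s. exp (real t * \<epsilon>)) \<ge> 0"
      using \<open>\<delta> \<ge> 0\<close> by (intro mult_nonneg_nonneg sum_nonneg) auto
    from add_mono[OF grow this] show ?thesis by (simp only: eq add_0_right)
  next
    case False
    then obtain i where i: "i \<in> D" by blast
    have [simp]: "finite D" by (simp add: D_def)
    define Y where "Y = X[i := X' ! i]"
    have len: "length X = n" "length X' = n" using Suc.prems X' by (auto simp: datasets_def)
    have "X' ! i \<in> \<Omega>" using X' i by (auto simp: D_def datasets_def)
    then have Y: "Y \<in> datasets \<Omega> n"
      using Suc.prems(1) set_update_subset_insert[of X i "X' ! i"] by (auto simp: datasets_def Y_def)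
    have "{j. j < n \<and> X ! j \<noteq> Y ! j} \<subseteq> {i}"
      unfolding Y_def by clarsimp (metis nth_list_update_neq)
    then have "card {j. j < n \<and> X ! j \<noteq> Y ! j} \<le> 1"
      by (metis card_mono card.empty card_insert_if finite.intros finite_insert empty_iff One_nat_def)
    then have step: "measure (M X) S \<le> exp \<epsilon> * measure (M Y) S + \<delta>"
      using dp Suc.prems(1) Y S unfolding differentially_private_def by blast
    have "{j. j < n \<and> Y ! j \<noteq> X' ! j} = D - {i}"
      using i len by (auto simp: Y_def D_def nth_list_update)
    then have "card {j. j < n \<and> Y ! j \<noteq> X' ! j} \<le> s"
      using Suc.prems(2) i by (simp add: D_def[symmetric])
    from Suc.IH[OF Y this] have "exp \<epsilon> * measure (M Y) S \<le>
        exp \<epsilon> * (exp (real s * \<epsilon>) * measure (M X') S + \<delta> * (\<Sum>t<s. exp (real t * \<epsilon>)))"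
      by (intro mult_left_mono) auto
    with step have "measure (M X) S \<le>
        exp \<epsilon> * (exp (real s * \<epsilon>) * measure (M X') S + \<delta> * (\<Sum>t<s. exp (real t * \<epsilon>))) + \<delta>"
      by linarith
    also have "\<dots> = exp (real (Suc s) * \<epsilon>) * measure (M X') S + \<delta> * (\<Sum>t<Suc s. exp (real t * \<epsilon>))"
      unfolding sum.lessThan_Suc_shift
      by (simp add: exp_add algebra_simps sum_distrib_left)
    finally show ?thesis .
  qed
qed

lemma sum_count_eq_sum_mset:
  fixes f :: "'a \<Rightarrow> real"
  assumes "finite S" "set_mset Y \<subseteq> S"
  shows "(\<Sum>y\<in>S. real (count Y y) * f y) = (\<Sum>y\<in>#Y. f y)"
  using assms(2)
proof (induction Y)
  case (add x Y)
  have "(\<Sum>y\<in>S. real (count (add_mset x Y) y) * f y) =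
      (\<Sum>y\<in>S. real (count Y y) * f y + (if x = y then f y else 0))"
    by (intro sum.cong) (auto simp: algebra_simps)
  then show ?case using add assms(1) by (simp add: sum.distrib)
qed simp

lemma integral_empirical:
  fixes f :: "'a \<Rightarrow> real"
  assumes "Y \<noteq> {#}"
  shows "(\<integral>x. f x \<partial>empirical Y) = (\<Sum>y\<in>#Y. f y) / size Y"
proof -
  have "(\<integral>x. f x \<partial>empirical Y) = (\<Sum>y\<in>set_mset Y. f y * (count Y y / size Y))"
    unfolding empirical_def using assms
    by (subst integral_measure_pmf_real[of "set_mset Y"]) auto
  also have "\<dots> = (\<Sum>y\<in>set_mset Y. real (count Y y) * f y) / size Y"
    by (simp add: sum_divide_distrib mult.commute)
  finally show ?thesis by (simp add: sum_count_eq_sum_mset)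
qed

lemma integrable_empirical:
  "Y \<noteq> {#} \<Longrightarrow> integrable (empirical Y) (f :: 'a \<Rightarrow> real)"
  unfolding empirical_def by (rule integrable_measure_pmf_finite) simp

lemma space_synthetic_space [simp]: "space (synthetic_space d) = synthetic_data d"
  unfolding synthetic_space_def by (rule space_measure_of) auto

lemma count_measurable:
  assumes "B \<in> sets (restrict_space borel (cube d))"
  shows "(\<lambda>Y. size (filter_mset (\<lambda>x. x \<in> B) Y)) \<in> measurable (synthetic_space d) (count_space UNIV)"
proof (subst measurable_count_space_eq2_countable, intro conjI ballI)
  fix j :: nat
  have "{Y \<in> synthetic_data d. size (filter_mset (\<lambda>x. x \<in> B) Y) = j} \<in> sets (synthetic_space d)"
    unfolding synthetic_space_def using assms by (intro in_measure_of) auto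
  then show "(\<lambda>Y. size (filter_mset (\<lambda>x. x \<in> B) Y)) -` {j} \<inter> space (synthetic_space d) \<in>
      sets (synthetic_space d)"
    by (simp add: vimage_def Int_def conj_commute)
qed simp

text \<open>
  The \<open>\<sigma>\<close>-algebra on multisets is generated by the counting maps, so this is clear for indicators,
  where the integral is a quotient of two counts. The general case follows by approximation. Privacy compares probabilities of measurable
  events only, hence the argument below works with events about one test function at a time.
\<close>

lemma nn_integral_empirical_measurable:
  assumes "f \<in> borel_measurable (restrict_space borel (cube d))"
  shows "(\<lambda>Y. \<integral>\<^sup>+x. f x \<partial>empirical Y) \<in> borel_measurable (synthetic_space d)"
  using assms
proof (induction rule: borel_measurable_induct)
  case (cong f g)
  have "(\<integral>\<^sup>+x. f x \<partial>empirical Y) = (\<integral>\<^sup>+x. g x \<partial>empirical Y)" if "Y \<in> synthetic_data d" for Y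
    using that cong(3) unfolding empirical_def
    by (intro nn_integral_cong_AE) (auto simp: AE_measure_pmf_iff synthetic_data_def space_restrict_space subset_iff)
  then show ?case
    by (subst measurable_cong[of _ _ "\<lambda>Y. \<integral>\<^sup>+x. g x \<partial>empirical Y"]) (use cong(4) in auto)
next
  case (set A)
  \<comment> \<open>The size of \<open>Y\<close> is itself a count, namely that of the points in the whole cube.\<close>
  have cube: "cube d \<in> sets (restrict_space borel (cube d))"
    by (metis inf_top.right_neutral sets.top space_borel space_restrict_space)
  have "emeasure (empirical Y) A =
      ennreal (size (filter_mset (\<lambda>x. x \<in> A) Y) / size (filter_mset (\<lambda>x. x \<in> cube d) Y))"
    if "Y \<in> synthetic_data d" for Y
  proof -
    have Y: "Y \<noteq> {#}" "filter_mset (\<lambda>x. x \<in> cube d) Y = Y"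
      using that by (auto simp: synthetic_data_def filter_mset_eq_conv)
    have "measure (empirical Y) A = (\<integral>x. indicator A x \<partial>empirical Y)"
      by (simp add: empirical_def)
    also have "\<dots> = (\<Sum>y\<in>#Y. indicator A y) / size Y"
      by (rule integral_empirical[OF Y(1)])
    also have "(\<Sum>y\<in>#Y. indicator A y :: real) = size (filter_mset (\<lambda>x. x \<in> A) Y)"
      by (induction Y) auto
    finally show ?thesis using Y by (simp add: empirical_def measure_pmf.emeasure_eq_measure)
  qed
  moreover have "(\<lambda>Y. ennreal (size (filter_mset (\<lambda>x. x \<in> A) Y) /
      size (filter_mset (\<lambda>x. x \<in> cube d) Y))) \<in> borel_measurable (synthetic_space d)"
    using measurable_compose[OF count_measurable[OF set], of real borel]
      measurable_compose[OF count_measurable[OF cube], of real borel]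
    by (intro measurable_compose[OF _ measurable_ennreal] borel_measurable_divide) auto
  moreover have "(\<integral>\<^sup>+x. indicator A x \<partial>empirical Y) = emeasure (empirical Y) A" for Y
    by (simp add: empirical_def)
  ultimately show ?case
    by (subst measurable_cong) auto
next
  case (mult u c)
  then show ?case by (simp add: empirical_def nn_integral_cmult)
next
  case (add u v)
  then show ?case by (simp add: empirical_def nn_integral_add)
next
  case (seq U)
  have "(\<integral>\<^sup>+x. (SUP i. U i) x \<partial>empirical Y) = (SUP i. \<integral>\<^sup>+x. U i x \<partial>empirical Y)" for Y
    using seq(3) unfolding empirical_def SUP_apply
    by (intro nn_integral_monotone_convergence_SUP) auto
  with seq show ?case by simp
qed

section \<open>Assouad's method for private algorithms\<close>

text \<open>
  Adding or removing \<open>j\<close> is an involution on the subsets of \<open>{..<N}\<close>, so a lower bound for pairs of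
  neighbours is a lower bound for twice the average.
\<close>

lemma sum_flip_ge:
  fixes g :: "nat set \<Rightarrow> real"
  assumes j: "j < N"
    and pair: "\<And>b. b \<subseteq> {..<N} \<Longrightarrow> j \<notin> b \<Longrightarrow> c \<le> g b + g (insert j b)"
  shows "2 ^ N * c \<le> 2 * (\<Sum>b\<in>Pow {..<N}. g b)"
proof -
  define flip where "flip b = (if j \<in> b then b - {j} else insert j b)" for b
  have "bij_betw flip (Pow {..<N}) (Pow {..<N})"
    by (rule bij_betw_byWitness[where f' = flip]) (use j in \<open>auto simp: flip_def\<close>)
  then have "(\<Sum>b\<in>Pow {..<N}. g (flip b)) = (\<Sum>b\<in>Pow {..<N}. g b)"
    by (rule sum.reindex_bij_betw)
  then have "2 * (\<Sum>b\<in>Pow {..<N}. g b) = (\<Sum>b\<in>Pow {..<N}. g b + g (flip b))"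
    by (simp add: sum.distrib)
  moreover have "c \<le> g b + g (flip b)" if "b \<subseteq> {..<N}" for b
  proof (cases "j \<in> b")
    case True
    then have "insert j (b - {j}) = b" by auto
    then show ?thesis using pair[of "b - {j}"] that True by (auto simp: flip_def add.commute)
  qed (use pair that in \<open>simp add: flip_def\<close>)
  then have "(\<Sum>b\<in>Pow {..<N}. c) \<le> (\<Sum>b\<in>Pow {..<N}. g b + g (flip b))"
    by (intro sum_mono) auto
  ultimately show ?thesis by (simp add: card_Pow)
qed

text \<open>
  The core argument, for an abstract family of test functions \<open>\<phi> j\<close> that detect the points \<open>z j\<close>.
  The constant \<open>8 * L\<close> collects: the threshold \<open>s / (2 * n)\<close> halfway between the two possible means; the
  bound \<open>1 / (2 * L)\<close> for the sum of the error probabilities of two neighbours; and a factor 2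
  from averaging over pairs.
\<close>

lemma assouad_lower_bound:
  fixes \<phi> :: "nat \<Rightarrow> point \<Rightarrow> real"
  assumes M: "M \<in> private_algorithms d n \<epsilon> \<delta>" and "\<epsilon> \<ge> 0" "\<delta> \<ge> 0"
    and ns: "n \<ge> 1" "s \<ge> 1" "N * s \<le> n"
    and L: "exp (real s * \<epsilon>) \<le> L" and \<delta>: "\<delta> * (\<Sum>t<s. exp (real t * \<epsilon>)) \<le> 1 / 2"
    and wz: "w \<in> cube d" "z \<in> {..<N} \<rightarrow> cube d"
    and cont: "\<And>j. j < N \<Longrightarrow> continuous_on (cube d) (\<phi> j)"
    and nonneg: "\<And>j x. j < N \<Longrightarrow> \<phi> j x \<ge> 0"
    and \<phi>w: "\<And>j. j < N \<Longrightarrow> \<phi> j w = 0"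
    and \<phi>z: "\<And>i j. i < N \<Longrightarrow> j < N \<Longrightarrow> \<phi> j (z i) = of_bool (i = j)"
    and K: "K > 0"
    and F: "\<And>\<sigma>. (\<forall>j<N. \<bar>\<sigma> j\<bar> \<le> 1) \<Longrightarrow> (\<lambda>x. \<Sum>j<N. \<sigma> j / K * \<phi> j x) \<in> F_k d k"
  shows "\<exists>X\<in>datasets (cube d) n.
    ennreal (real N * real s / (8 * L * real n * K)) \<le>
    (\<integral>\<^sup>+Y. d_k d k (empirical (mset X)) (empirical Y) \<partial>M X)"
proof -
  have dp: "differentially_private \<epsilon> \<delta> (cube d) n (synthetic_space d) M"
    using M by (simp add: private_algorithms_def)
  have "1 \<le> exp (real s * \<epsilon>)" using \<open>\<epsilon> \<ge> 0\<close> by simp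
  with L have L1: "L \<ge> 1" by linarith
  define X where
    "X b = map (\<lambda>i. if i < N * s \<and> i div s \<in> b then z (i div s) else w) [0..<n]" for b
  have block: "i div s = j \<longleftrightarrow> i \<in> {j * s..<Suc j * s}" for i j
    using ns(2) div_nat_eqI[of s j i] div_times_less_eq_dividend[of i s]
      dividend_less_times_div[of s i] by (auto simp: mult.commute)
  have block_le: "{j * s..<Suc j * s} \<subseteq> {..<N * s}" if "j < N" for j
  proof -
    have "Suc j * s \<le> N * s" using that by (intro mult_right_mono) auto
    then show ?thesis by auto
  qed
  have X: "X b \<in> datasets (cube d) n" for b
    using wz by (auto simp: X_def datasets_def less_mult_imp_div_less)
  have mean_X: "(\<integral>x. \<phi> j x \<partial>empirical (mset (X b))) = of_bool (j \<in> b) * s / n" if j: "j < N" for j b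
  proof -
    have "X b \<noteq> []" using ns by (simp add: X_def)
    moreover have "(\<Sum>y\<in>#mset (X b). \<phi> j y) = (\<Sum>i<length (X b). \<phi> j (X b ! i))"
      by (simp add: sum_mset_sum_list sum_list_sum_nth lessThan_atLeast0 flip: mset_map)
    ultimately have "(\<integral>x. \<phi> j x \<partial>empirical (mset (X b))) = (\<Sum>i<n. \<phi> j (X b ! i)) / n"
      by (simp add: integral_empirical) (simp add: X_def)
    also have "(\<Sum>i<n. \<phi> j (X b ! i)) = (\<Sum>i<n. if i \<in> {j * s..<Suc j * s} then of_bool (j \<in> b) else 0)"
    proof (rule sum.cong[OF refl])
      fix i assume "i \<in> {..<n}"
      moreover have "i div s < N" if "i < N * s" using that by (simp add: less_mult_imp_div_less)
      moreover have "i < N * s" if "i \<in> {j * s..<Suc j * s}"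
        using block_le[OF j] that by (meson lessThan_iff subsetD)
      ultimately show "\<phi> j (X b ! i) = (if i \<in> {j * s..<Suc j * s} then of_bool (j \<in> b) else 0)"
        using block[of i j] \<phi>w[OF j] \<phi>z[OF _ j] by (auto simp: X_def)
    qed
    also have "\<dots> = (\<Sum>i\<in>{j * s..<Suc j * s}. of_bool (j \<in> b))"
      using block_le[OF j] ns(3) by (intro sum.mono_neutral_cong_right) auto
    finally show ?thesis by simp
  qed
  have adjacent: "card {i. i < n \<and> X b ! i \<noteq> X (insert j b) ! i} \<le> s" for j b
  proof -
    have "{i. i < n \<and> X b ! i \<noteq> X (insert j b) ! i} \<subseteq> {j * s..<Suc j * s}"
    proof clarify
      fix i assume "i < n" "X b ! i \<noteq> X (insert j b) ! i"
      then have "i div s = j" by (auto simp: X_def split: if_splits)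
      then show "i \<in> {j * s..<Suc j * s}" using block by blast
    qed
    from card_mono[OF _ this] show ?thesis by simp
  qed
  have prob: "prob_space (M (X b))" and sets_M: "sets (M (X b)) = sets (synthetic_space d)" for b
    using M X[of b] by (auto simp: private_algorithms_def randomized_algorithm_def space_prob_algebra)
  have space_M: "space (M (X b)) = synthetic_data d" for b
    using sets_eq_imp_space_eq[OF sets_M[of b]] by simp
  \<comment> \<open>The outputs that indicate \<open>j \<notin> b\<close>.\<close>
  define low where "low j = {Y \<in> synthetic_data d. (\<integral>x. \<phi> j x \<partial>empirical Y) \<le> s / (2 * n)}" for j
  have low: "low j \<in> sets (synthetic_space d)" if "j < N" for j
  proof -
    have "(\<lambda>x. ennreal (\<phi> j x)) \<in> borel_measurable (restrict_space borel (cube d))"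
      using cont[OF that] by (intro measurable_compose[OF borel_measurable_continuous_on_restrict]) auto
    from nn_integral_empirical_measurable[OF this]
    have "{Y \<in> space (synthetic_space d). (\<integral>\<^sup>+x. ennreal (\<phi> j x) \<partial>empirical Y) \<le> ennreal (s / (2 * n))}
        \<in> sets (synthetic_space d)"
      by measurable
    also have "{Y \<in> space (synthetic_space d). (\<integral>\<^sup>+x. ennreal (\<phi> j x) \<partial>empirical Y) \<le> ennreal (s / (2 * n))}
        = low j"
    proof -
      have "(\<integral>\<^sup>+x. ennreal (\<phi> j x) \<partial>empirical Y) = ennreal (\<integral>x. \<phi> j x \<partial>empirical Y)"
        if "Y \<in> synthetic_data d" for Y
        using that nonneg[OF \<open>j < N\<close>]
        by (intro nn_integral_eq_integral integrable_empirical) (auto simp: synthetic_data_def)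
      then show ?thesis by (auto simp: low_def)
    qed
    finally show ?thesis .
  qed
  define bad where "bad b j = (if j \<in> b then low j else synthetic_data d - low j)" for b j
  have bad: "bad b j \<in> sets (synthetic_space d)" if "j < N" for b j
    using low[OF that] sets.compl_sets[OF low[OF that]] by (auto simp: bad_def)
  define g where "g b j = measure (M (X b)) (bad b j)" for b j
  have pair: "1 / (2 * L) \<le> g b j + g (insert j b) j" if j: "j < N" "j \<notin> b" for b j
  proof -
    define a a' where "a = measure (M (X b)) (low j)" and "a' = measure (M (X (insert j b))) (low j)"
    have "g b j = 1 - a"
      using prob_space.prob_compl[OF prob, of "low j" b] low[OF j(1)] j(2)
      by (simp add: g_def bad_def a_def sets_M space_M)
    moreover have "g (insert j b) j = a'" by (simp add: g_def bad_def a'_def)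
    moreover have "a \<le> exp (real s * \<epsilon>) * a' + \<delta> * (\<Sum>t<s. exp (real t * \<epsilon>))"
      unfolding a_def a'_def
      by (rule group_privacy[OF dp \<open>\<epsilon> \<ge> 0\<close> \<open>\<delta> \<ge> 0\<close> X X adjacent low[OF j(1)]])
    moreover have "exp (real s * \<epsilon>) * a' \<le> L * a'"
      using L by (intro mult_right_mono) (auto simp: a'_def)
    moreover have "1 * (1 - a) \<le> L * (1 - a)"
      using L1 prob_space.prob_le_1[OF prob] by (intro mult_right_mono) (auto simp: a_def)
    ultimately have "1 / 2 \<le> L * (g b j + g (insert j b) j)"
      using \<delta> by (simp add: distrib_left)
    then show ?thesis using L1 by (simp add: field_simps)
  qed
  obtain b where b: "b \<subseteq> {..<N}" "real N / (4 * L) \<le> (\<Sum>j<N. g b j)"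
  proof -
    have "2 ^ N * (real N / (2 * L)) = (\<Sum>j<N. 2 ^ N * (1 / (2 * L)))" by simp
    also have "\<dots> \<le> (\<Sum>j<N. 2 * (\<Sum>b\<in>Pow {..<N}. g b j))"
      by (intro sum_mono sum_flip_ge) (use pair in auto)
    also have "\<dots> = 2 * (\<Sum>b\<in>Pow {..<N}. \<Sum>j<N. g b j)"
      by (subst sum.swap) (simp add: sum_distrib_left)
    finally have avg: "(\<Sum>b\<in>Pow {..<N}. real N / (4 * L)) \<le> (\<Sum>b\<in>Pow {..<N}. \<Sum>j<N. g b j)"
      by (simp add: card_Pow)
    have "\<exists>b\<in>Pow {..<N}. real N / (4 * L) \<le> (\<Sum>j<N. g b j)"
    proof (rule ccontr)
      assume "\<not> ?thesis"
      then have "(\<Sum>b\<in>Pow {..<N}. \<Sum>j<N. g b j) < (\<Sum>b\<in>Pow {..<N}. real N / (4 * L))"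
        by (intro sum_strict_mono) (auto simp: not_le)
      with avg show False by linarith
    qed
    with that show ?thesis by auto
  qed
  define c where "c = real s / (2 * n * K)"
  have c: "c \<ge> 0" using K by (simp add: c_def)
  have pointwise: "ennreal (c * (\<Sum>j<N. indicator (bad b j) Y)) \<le>
      d_k d k (empirical (mset (X b))) (empirical Y)" if Y: "Y \<in> synthetic_data d" for Y
  proof -
    \<comment> \<open>The signs of the deviations turn the linear functional into their absolute sum.\<close>
    define e where "e j = (\<integral>x. \<phi> j x \<partial>empirical (mset (X b))) - (\<integral>x. \<phi> j x \<partial>empirical Y)" for j
    define f where "f x = (\<Sum>j<N. sgn (e j) / K * \<phi> j x)" for x
    have ne: "Y \<noteq> {#}" "mset (X b) \<noteq> {#}"
      using Y ns(1) X[of b] by (auto simp: synthetic_data_def datasets_def)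
    have int_f: "(\<integral>x. f x \<partial>empirical Z) = (\<Sum>j<N. sgn (e j) / K * (\<integral>x. \<phi> j x \<partial>empirical Z))"
      if "Z \<noteq> {#}" for Z
      unfolding f_def using integrable_empirical[OF that]
      by (subst Bochner_Integration.integral_sum) auto
    have gap: "s / (2 * n) * indicator (bad b j) Y \<le> \<bar>e j\<bar>" if "j < N" for j
      using Y mean_X[OF that, of b]
      by (auto simp: e_def bad_def low_def indicator_def field_simps split: if_splits)
    have "c * (\<Sum>j<N. indicator (bad b j) Y) = (\<Sum>j<N. s / (2 * n) * indicator (bad b j) Y) / K"
      by (simp add: c_def sum_distrib_left sum_divide_distrib)
    also have "\<dots> \<le> (\<Sum>j<N. \<bar>e j\<bar>) / K"
      using K gap by (intro divide_right_mono sum_mono) auto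
    also have "\<dots> = (\<Sum>j<N. sgn (e j) / K * e j)"
      by (simp add: sum_divide_distrib abs_sgn mult.commute)
    also have "\<dots> = (\<integral>x. f x \<partial>empirical (mset (X b))) - (\<integral>x. f x \<partial>empirical Y)"
      unfolding int_f[OF ne(1)] int_f[OF ne(2)] sum_subtractf[symmetric]
      by (simp add: e_def right_diff_distrib)
    also have "\<dots> \<le> \<bar>\<dots>\<bar>" by simp
    finally have "ennreal (c * (\<Sum>j<N. indicator (bad b j) Y)) \<le>
        ennreal \<bar>(\<integral>x. f x \<partial>empirical (mset (X b))) - (\<integral>x. f x \<partial>empirical Y)\<bar>"
      by (rule ennreal_leI)
    also have "f \<in> F_k d k"
      unfolding f_def[abs_def] by (rule F) (auto simp: sgn_if)
    then have "ennreal \<bar>(\<integral>x. f x \<partial>empirical (mset (X b))) - (\<integral>x. f x \<partial>empirical Y)\<bar> \<le>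
        d_k d k (empirical (mset (X b))) (empirical Y)"
      unfolding d_k_def by (rule SUP_upper)
    finally show ?thesis .
  qed
  interpret prob_space "M (X b)" by (rule prob)
  have "real N * real s / (8 * L * real n * K) = c * (real N / (4 * L))"
    by (simp add: c_def mult_ac)
  also have "\<dots> \<le> c * (\<Sum>j<N. g b j)"
    using b(2) c by (rule mult_left_mono)
  finally have "ennreal (real N * real s / (8 * L * real n * K)) \<le> ennreal (c * (\<Sum>j<N. g b j))"
    by (rule ennreal_leI)
  also have "\<dots> = ennreal (\<integral>Y. c * (\<Sum>j<N. indicator (bad b j) Y) \<partial>M (X b))"
    using bad by (simp add: g_def sets_M Bochner_Integration.integral_sum emeasure_eq_measure)
  also have "\<dots> = (\<integral>\<^sup>+Y. ennreal (c * (\<Sum>j<N. indicator (bad b j) Y)) \<partial>M (X b))"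
    using bad c by (intro nn_integral_eq_integral[symmetric])
      (auto simp: sets_M emeasure_eq_measure intro!: AE_I2 mult_nonneg_nonneg sum_nonneg)
  also have "\<dots> \<le> (\<integral>\<^sup>+Y. d_k d k (empirical (mset (X b))) (empirical Y) \<partial>M (X b))"
    by (intro nn_integral_mono pointwise) (simp add: space_M)
  finally show ?thesis using X by blast
qed

section \<open>The choice of the parameters\<close>

lemma grid_size_exists:
  fixes N d :: nat
  assumes "N \<ge> 1" "d \<ge> 1"
  obtains m :: nat where "m \<ge> 1" "N \<le> m ^ d" "real m \<le> 2 * real N powr (1 / d)"
proof -
  define r where "r = real N powr (1 / d)"
  have r: "r \<ge> 1" unfolding r_def using assms by (intro ge_one_powr_ge_zero) auto
  have "real N = r ^ d" using assms by (simp add: r_def powr_realpow[symmetric] powr_powr)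
  also have "\<dots> \<le> real (nat \<lceil>r\<rceil>) ^ d" using r by (intro power_mono) linarith+
  finally have "N \<le> nat \<lceil>r\<rceil> ^ d" by (metis of_nat_le_iff of_nat_power)
  moreover have "nat \<lceil>r\<rceil> \<ge> 1" "real (nat \<lceil>r\<rceil>) \<le> 2 * r" using r by linarith+
  ultimately show ?thesis using that unfolding r_def by blast
qed

text \<open>
  The group size is \<open>s = \<lceil>1 / \<epsilon>\<rceil>\<close>: large enough that moving \<open>s\<close> points changes means by \<open>1 / (n * \<epsilon>)\<close>, and
  small enough that privacy for groups of \<open>s\<close> points loses only a constant factor. The hypothesis on
  \<open>\<epsilon>\<close> from below gives \<open>s \<le> n\<close>; the hypothesis on \<open>\<delta>\<close> cancels the denominator of the geometric sum.
\<close>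

lemma group_size:
  fixes c1 \<epsilon> \<delta> :: real and n :: nat
  assumes "c1 > 1" "n \<ge> 1" "c1 / real n < \<epsilon>" "\<epsilon> < c1" "0 \<le> \<delta>"
    and \<delta>: "\<delta> < (exp \<epsilon> - 1) / (2 * exp (1 + c1))"
  obtains s :: nat where "s \<ge> 1" "s \<le> n" "1 \<le> s * \<epsilon>" "exp (s * \<epsilon>) \<le> exp (1 + c1)"
    "\<delta> * (\<Sum>t<s. exp (real t * \<epsilon>)) \<le> 1 / 2"
proof -
  define s where "s = nat \<lceil>1 / \<epsilon>\<rceil>"
  have \<epsilon>: "\<epsilon> > 0" using assms(1,3) by (smt (verit) divide_nonneg_nonneg of_nat_0_le_iff)
  have inv: "1 / \<epsilon> > 0" using \<epsilon> by simp
  have "1 / \<epsilon> \<le> n" using assms(1-3) \<epsilon> by (simp add: field_simps)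
  then have "s \<le> n" unfolding s_def by linarith
  have s: "1 / \<epsilon> \<le> s" "s \<le> 1 / \<epsilon> + 1" "s \<ge> 1" using inv unfolding s_def by linarith+
  have "1 \<le> s * \<epsilon>" using s(1) \<epsilon> by (simp add: field_simps)
  have "s * \<epsilon> \<le> (1 / \<epsilon> + 1) * \<epsilon>" using s(2) \<epsilon> by (intro mult_right_mono) auto
  also have "\<dots> = 1 + \<epsilon>" using \<epsilon> by (simp add: field_simps)
  finally have expo: "exp (s * \<epsilon>) \<le> exp (1 + c1)" using assms(4) by simp
  have e1: "exp \<epsilon> - 1 > 0" using \<epsilon> by simp
  have "(\<Sum>t<s. exp (real t * \<epsilon>)) = (exp \<epsilon> ^ s - 1) / (exp \<epsilon> - 1)"
    using e1 geometric_sum[of "exp \<epsilon>" s] by (simp add: exp_of_nat_mult)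
  also have "\<dots> = (exp (s * \<epsilon>) - 1) / (exp \<epsilon> - 1)" by (simp add: exp_of_nat_mult)
  also have "\<dots> \<le> exp (1 + c1) / (exp \<epsilon> - 1)"
    using expo e1 by (intro divide_right_mono; linarith)
  finally have "\<delta> * (\<Sum>t<s. exp (real t * \<epsilon>)) \<le>
      (exp \<epsilon> - 1) / (2 * exp (1 + c1)) * (exp (1 + c1) / (exp \<epsilon> - 1))"
    using assms(5) \<delta> by (intro mult_mono) (auto intro!: sum_nonneg)
  also have "\<dots> = 1 / 2" using e1 by simp
  finally show ?thesis using that \<open>s \<le> n\<close> \<open>1 \<le> s * \<epsilon>\<close> s expo by blast
qed

text \<open>
  One cell if \<open>d \<le> k\<close>, and otherwise as many cells as there are groups of \<open>s\<close> data points.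
\<close>

lemma grid_lower_bound:
  fixes n d k s :: nat and B L \<epsilon> :: real
  assumes "B \<ge> 1" "L > 0" "n \<ge> 1" "s \<ge> 1" "s \<le> n" "1 \<le> s * \<epsilon>" "\<epsilon> > 0" "d \<ge> 1"
  obtains N m :: nat where "m \<ge> 1" "N \<le> m ^ d" "N * s \<le> n"
    "1 / (16 * L * (2 * B) ^ k) * (n * \<epsilon>) powr (- min 1 (k / d)) \<le>
      real N * real s / (8 * L * n * (B * m) ^ k)"
proof (cases "d \<le> k")
  case True
  have "1 / (16 * L * (2 * B) ^ k) * (n * \<epsilon>) powr (- min 1 (k / d)) =
      (1 / (8 * L * n * B ^ k)) * (1 / (\<epsilon> * 2 ^ Suc k))"
    using assms True by (simp add: min_absorb1 powr_minus_divide power_mult_distrib field_simps)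
  also have "\<dots> \<le> (1 / (8 * L * n * B ^ k)) * s"
  proof (rule mult_left_mono)
    have "1 \<le> (s * \<epsilon>) * 2 ^ Suc k"
      using mult_mono[of 1 "s * \<epsilon>" 1 "2 ^ Suc k"] assms(6) by (simp add: one_le_power del: power_Suc)
    then show "1 / (\<epsilon> * 2 ^ Suc k) \<le> s" using assms(7) by (simp add: field_simps)
  qed (use assms in auto)
  finally show ?thesis using assms by (intro that[of 1 1]) auto
next
  case False
  define N where "N = n div s"
  have N1: "N \<ge> 1" using assms by (simp add: N_def Suc_le_eq div_greater_zero_iff)
  have Ns: "N * s \<le> n" by (simp add: N_def)
  have "n < N * s + s" using assms dividend_less_div_times[of s n] by (simp add: N_def)
  also have "\<dots> \<le> 2 * (N * s)" using N1 by simp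
  finally have half: "real n \<le> 2 * (real N * s)" by (metis less_imp_le of_nat_le_iff of_nat_mult of_nat_numeral)
  obtain m where m: "m \<ge> 1" "N \<le> m ^ d" "real m \<le> 2 * real N powr (1 / d)"
    using grid_size_exists[OF N1 assms(8)] by blast
  have "real N * 1 \<le> real N * (s * \<epsilon>)" using assms(6) by (intro mult_left_mono) auto
  also have "\<dots> \<le> n * \<epsilon>" using Ns assms(7)
    by (metis mult.assoc mult_right_mono less_imp_le of_nat_le_iff of_nat_mult)
  finally have "real N \<le> n * \<epsilon>" by simp
  then have "real m \<le> 2 * (n * \<epsilon>) powr (1 / d)"
    using m(3) powr_mono2[of "1 / d" "real N" "n * \<epsilon>"] by simp
  then have "real m ^ k \<le> (2 * (n * \<epsilon>) powr (1 / d)) ^ k" by (rule power_mono) simp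
  also have "\<dots> = 2 ^ k * (n * \<epsilon>) powr (k / d)"
    using assms by (simp add: power_mult_distrib powr_power)
  finally have mk: "real m ^ k \<le> 2 ^ k * (n * \<epsilon>) powr (k / d)" .
  have pos: "(n * \<epsilon>) powr (k / d) > 0" using assms by simp
  have "1 / (16 * L * (2 * B) ^ k) * (n * \<epsilon>) powr (- min 1 (k / d)) =
      1 / (16 * L * B ^ k) * (1 / (2 ^ k * (n * \<epsilon>) powr (k / d)))"
    using assms False by (simp add: min_def powr_minus_divide power_mult_distrib)
  also have "\<dots> \<le> 1 / (16 * L * B ^ k) * (1 / real m ^ k)"
    using mk m(1) assms pos by (intro mult_left_mono divide_left_mono) auto
  also have "\<dots> = 1 / (8 * L * (B * m) ^ k) * (1 / 2)"
    by (simp add: power_mult_distrib)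
  also have "\<dots> \<le> 1 / (8 * L * (B * m) ^ k) * (N * s / n)"
    using half assms by (intro mult_left_mono) (auto simp: field_simps)
  finally show ?thesis using that[OF m(1,2) Ns] by (simp add: field_simps)
qed

theorem theorem4:
  fixes c1 :: real
  assumes "c1 > 1"
  shows "\<exists>c2::real. c2 > 0 \<and> (\<forall>k::nat. k \<ge> 1 \<longrightarrow> (\<exists>C::real. C > 0 \<and>
    (\<forall>(n::nat) (d::nat) (\<epsilon>::real) (\<delta>::real).
       n \<ge> 1 \<longrightarrow> d \<ge> 1 \<longrightarrow> \<epsilon> \<in> {c1 / real n <..< c1} \<longrightarrow> \<delta> \<in> {0 ..< c2 * (exp \<epsilon> - 1)} \<longrightarrow>
       (INF M \<in> private_algorithms d n \<epsilon> \<delta>. SUP X \<in> datasets (cube d) n.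
          \<integral>\<^sup>+ Y. d_k d k (empirical (mset X)) (empirical Y) \<partial>M X)
       \<ge> ennreal (C * (real n * \<epsilon>) powr (- min 1 (real k / real d))))))"
proof -
  define L where "L = exp (1 + c1)"
  have L: "L > 0" by (simp add: L_def)
  show ?thesis
  proof (rule exI[of _ "1 / (2 * L)"], intro conjI allI impI)
    fix k :: nat
    show "\<exists>C::real. C > 0 \<and>
      (\<forall>(n::nat) (d::nat) (\<epsilon>::real) (\<delta>::real).
         n \<ge> 1 \<longrightarrow> d \<ge> 1 \<longrightarrow> \<epsilon> \<in> {c1 / real n <..< c1} \<longrightarrow> \<delta> \<in> {0 ..< 1 / (2 * L) * (exp \<epsilon> - 1)} \<longrightarrow>
         (INF M \<in> private_algorithms d n \<epsilon> \<delta>. SUP X \<in> datasets (cube d) n.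
            \<integral>\<^sup>+ Y. d_k d k (empirical (mset X)) (empirical Y) \<partial>M X)
         \<ge> ennreal (C * (real n * \<epsilon>) powr (- min 1 (real k / real d))))"
    proof (rule bump_family[of k])
      fix B :: real
      assume B: "B \<ge> 1" and bumps: "\<And>(m::nat) d N. m \<ge> 1 \<Longrightarrow> d \<ge> 1 \<Longrightarrow> N \<le> m ^ d \<Longrightarrow>
        \<exists>(\<phi> :: nat \<Rightarrow> point \<Rightarrow> real) w z.
          w \<in> cube d \<and> z \<in> {..<N} \<rightarrow> cube d \<and>
          (\<forall>j<N. continuous_on (cube d) (\<phi> j) \<and> (\<forall>x. \<phi> j x \<ge> 0) \<and> \<phi> j w = 0 \<and>
            (\<forall>i<N. \<phi> j (z i) = of_bool (i = j))) \<and>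
          (\<forall>\<sigma>. (\<forall>j<N. \<bar>\<sigma> j\<bar> \<le> 1) \<longrightarrow> (\<lambda>x. \<Sum>j<N. \<sigma> j / (B * m) ^ k * \<phi> j x) \<in> F_k d k)"
      show ?thesis
      proof (intro exI[of _ "1 / (16 * L * (2 * B) ^ k)"] conjI allI impI INF_greatest)
        show "1 / (16 * L * (2 * B) ^ k) > 0" using L B by simp
        fix n d :: nat and \<epsilon> \<delta> :: real and M
        assume n: "n \<ge> 1" and d: "d \<ge> 1" and \<epsilon>: "\<epsilon> \<in> {c1 / real n <..< c1}"
          and \<delta>: "\<delta> \<in> {0 ..< 1 / (2 * L) * (exp \<epsilon> - 1)}" and M: "M \<in> private_algorithms d n \<epsilon> \<delta>"
        obtain s where s: "s \<ge> 1" "s \<le> n" "1 \<le> s * \<epsilon>" "exp (s * \<epsilon>) \<le> L"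
          "\<delta> * (\<Sum>t<s. exp (real t * \<epsilon>)) \<le> 1 / 2"
          using group_size[of c1 n \<epsilon> \<delta>] assms n \<epsilon> \<delta> by (auto simp: L_def)
        have \<epsilon>0: "\<epsilon> > 0" using s(1,3) by (smt (verit) mult_nonneg_nonpos of_nat_0_le_iff)
        obtain N m :: nat where Nm: "m \<ge> 1" "N \<le> m ^ d" "N * s \<le> n"
          and rate: "1 / (16 * L * (2 * B) ^ k) * (n * \<epsilon>) powr (- min 1 (k / d)) \<le>
            real N * real s / (8 * L * n * (B * m) ^ k)"
          using grid_lower_bound[OF B L n s(1-3) \<epsilon>0 d] by blast
        obtain \<phi> :: "nat \<Rightarrow> point \<Rightarrow> real" and w z where
          "w \<in> cube d" "z \<in> {..<N} \<rightarrow> cube d"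
          "\<forall>j<N. continuous_on (cube d) (\<phi> j) \<and> (\<forall>x. \<phi> j x \<ge> 0) \<and> \<phi> j w = 0 \<and>
            (\<forall>i<N. \<phi> j (z i) = of_bool (i = j))"
          "\<forall>\<sigma>. (\<forall>j<N. \<bar>\<sigma> j\<bar> \<le> 1) \<longrightarrow> (\<lambda>x. \<Sum>j<N. \<sigma> j / (B * m) ^ k * \<phi> j x) \<in> F_k d k"
          using bumps[OF Nm(1) d Nm(2)] by blast
        then have "\<exists>X\<in>datasets (cube d) n. ennreal (real N * real s / (8 * L * n * (B * m) ^ k)) \<le>
            (\<integral>\<^sup>+ Y. d_k d k (empirical (mset X)) (empirical Y) \<partial>M X)"
          using n s Nm \<epsilon>0 \<delta> B
          by (intro assouad_lower_bound[OF M, where \<phi> = \<phi> and w = w and z = z]) auto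
        then obtain X where X: "X \<in> datasets (cube d) n"
          "ennreal (real N * real s / (8 * L * n * (B * m) ^ k)) \<le>
            (\<integral>\<^sup>+ Y. d_k d k (empirical (mset X)) (empirical Y) \<partial>M X)" by blast
        have "ennreal (1 / (16 * L * (2 * B) ^ k) * (n * \<epsilon>) powr (- min 1 (k / d))) \<le>
            ennreal (real N * real s / (8 * L * n * (B * m) ^ k))"
          using rate by (rule ennreal_leI)
        also note X(2)
        also have "(\<integral>\<^sup>+ Y. d_k d k (empirical (mset X)) (empirical Y) \<partial>M X) \<le>
            (SUP X \<in> datasets (cube d) n. \<integral>\<^sup>+ Y. d_k d k (empirical (mset X)) (empirical Y) \<partial>M X)"
          using X(1) by (rule SUP_upper)
        finally show "ennreal (1 / (16 * L * (2 * B) ^ k) * (n * \<epsilon>) powr (- min 1 (k / d))) \<le>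
            (SUP X \<in> datasets (cube d) n. \<integral>\<^sup>+ Y. d_k d k (empirical (mset X)) (empirical Y) \<partial>M X)" .
      qed
    qed
  qed (use L in simp)
qed

end
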